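(* Let $X$ be one of the three varieties (Scenario 1, 2 or 3) described in the context, with its class $\delta$ and scalar product $\langle\cdot,\cdot\rangle$ on $\mathrm{Pic}(X)$, and let $B=\{\beta\in\mathrm{Pic}(X):\langle\beta,\beta\rangle=0,\ \langle\beta,\delta\rangle=2\}$. For any $\beta_1,\beta_2\in B$, we have $$I_{\beta_1}\circ I_{\beta_2}=T_{\beta_1-\beta_2},$$ where $I_\beta=(\mathcal I_\beta)_*$ is the action on $\mathrm{Pic}(X)$ induced by the birational involution $\mathcal I_\beta$, and $T_\alpha$ is the translation corresponding to $\alpha$ (both defined in the context). Thus, the birational map $\mathcal I_{\beta_1}\circ\mathcal I_{\beta_2}$ induces the translation $T_{\beta_1-\beta_2}$ on the Picard group.
   Context: **Scenario 1.** $P_1,\dots,P_9\in\mathbb P^2$ are nine points in special position in the sense that they support a pencil of cubic curves, but generic otherwise (no three points collinear, no six points on a conic). $X=\mathrm{Bl}_{P_1,\dots,P_9}(\mathbb P^2)$, $\mathrm{Pic}(X)=\mathbb ZD\oplus\mathbb ZE_1\oplus\dots\oplus\mathbb ZE_9$, where $D$ is the class of the total transform of a generic line and $E_i$ is the class of the exceptional divisor over $P_i$. $\langle\cdot,\cdot\rangle$ is the intersection number: the only nonzero products of basis elements are $\langle D,D\rangle=1$, $\langle E_i,E_i\rangle=-1$. $\delta=-K_X=3D-E_1-\dots-E_9$. **Scenario 2.** $P_1,\dots,P_8\in\mathbb P^1\times\mathbb P^1$ are eight points in special position in the sense that they support a pencil of biquadratic curves (i.e. $(2,2)$-curves), but generic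 otherwise. $X=\mathrm{Bl}_{P_1,\dots,P_8}(\mathbb P^1\times\mathbb P^1)$, $\mathrm{Pic}(X)=\mathbb ZH_1\oplus\mathbb ZH_2\oplus\mathbb ZE_1\oplus\dots\oplus\mathbb ZE_8$, where $H_1,H_2$ are the classes of the total transforms of a generic vertical, resp. horizontal, line and $E_i$ is the class of the exceptional divisor over $P_i$. $\langle\cdot,\cdot\rangle$ is the intersection number: the only nonzero products of basis elements are $\langle H_1,H_2\rangle=1$, $\langle E_i,E_i\rangle=-1$. $\delta=-K_X=2H_1+2H_2-E_1-\dots-E_8$. **Scenario 3.** $P_1,\dots,P_8\in\mathbb P^3$ are eight points in special position in the sense that they support a two-dimensional family (a net) of quadrics, but generic otherwise (no four points coplanar, etc.). $X=\mathrm{Bl}_{P_1,\dots,P_8}(\mathbb P^3)$, $\mathrm{Pic}(X)=\mathbb Z\Pi\oplus\mathbb ZE_1\oplus\dots\oplus\mathbb ZE_8$, where $\Pi$ is the class of the total transform of a generic plane and $E_i$ is the class of the exceptional divisor over $P_i$. $\delta=-\tfrac12K_X=2\Pi-E_1-\dots-E_8$. The scalar product is $\langle\mathcal D,\mathcal D'\rangle:=\mathcal D\cdot\mathcal D'\cdot\delta$ (triple intersection number); the only nonzero products of basis elements are $\langle\Pi,\Pi\rangle=2$, $\langle E_i,E_i\rangle=-1$. **The involution $\mathcal I_\beta$.** Let $d(\beta)$ be the dimension of the linear system of the divisor class $\beta$ and $g(\beta)$ the genus of a generic divisor of this class. By the formulas $2d(\beta)=\langle\beta,\beta\rangle+\langle\delta,\beta\rangle$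 and $2g(\beta)-2=\langle\beta,\beta\rangle-\langle\delta,\beta\rangle$, the relations defining $B$ are regarded as equivalent to $d(\beta)=1$, $g(\beta)=0$. The relation $d(\beta)=1$ means that through any generic point $P$ (not one of the base points) there is exactly one divisor $\beta_P$ of the class $\beta$. In Scenarios 1 and 2 there is exactly one divisor $\delta_P$ of the class $\delta$ through $P$; the intersection number of $\delta_P$ with $\beta_P$ is $\langle\delta,\beta\rangle=2$, so there is exactly one further intersection point $\widetilde P$ (different from $P$). In Scenario 3 there is a pencil of divisors of the class $\delta$ through $P$, spanned by $\delta_P^{(1)},\delta_P^{(2)}$, say; the triple intersection number of $\delta_P^{(1)}$, $\delta_P^{(2)}$ and $\beta_P$ is $\delta\cdot\delta\cdot\beta=\langle\delta,\beta\rangle=2$, so that again there is exactly one further intersection point $\widetilde P$ (different from $P$). In all scenarios, $\mathcal I_\beta(P):=\widetilde P$. $(\mathcal I_\beta)_*$ denotes the linear map on $\mathrm{Pic}(X)$ induced by $\mathcal I_\beta$; it is given by $I_\beta(\lambda)=-\lambda+\langle\lambda,\beta\rangle\,\delta+\langle\lambda,\delta\rangle\,\beta$. **Translations.** Let $Q=\{\alpha\in\mathrm{Pic}(X):\langle\alpha,\delta\rangle=0\}$ (a root lattice of affine type $E_8^{(1)}$ in Scenarios 1, 2 and $E_7^{(1)}$ in Scenario 3). For $\alpha\in Q$, the action of the translation $T_\alpha$ on $\mathrm{Pic}(X)$ is given by the Kac formula $$T_\alpha(\lambda)=\lambda+\langle\delta,\lambda\rangle\,\alpha-\Big(\tfrac12\langle\delta,\lambda\rangle\langle\alpha,\alpha\rangle+\langle\alpha,\lambda\rangle\Big)\delta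 .$$ Note that $\beta_1-\beta_2\in Q$ for $\beta_1,\beta_2\in B$. *)

theory Defs
  imports Complex_Main "HOL-Library.Function_Algebras" "HOL-Computational_Algebra.Polynomial"
begin

text \<open>The variety \<open>X\<close> is the blow-up of the projective plane in nine points, of
  the product of two projective lines in eight points, or of projective 3-space in eight points.\<close>

datatype scenario = P2_Nine | P1P1_Eight | P3_Eight

fun npts :: "scenario \<Rightarrow> nat" where
  "npts P2_Nine = 9"
| "npts P1P1_Eight = 8"
| "npts P3_Eight = 8"

text \<open>Basis of the Picard group: \<open>H 0\<close> is the pulled back line (plane) class of the
  projective plane (3-space); \<open>H 0\<close>, \<open>H 1\<close> are the pulled back classes of
  bidegree (1,0) and (0,1) in the product case; \<open>E i\<close> are the exceptional classes, numbered
  from 0. A divisor class is its coefficient function.\<close>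

datatype gen = H nat | E nat

type_synonym cls = "gen \<Rightarrow> int"

fun nblocks :: "scenario \<Rightarrow> nat" where
  "nblocks P2_Nine = 1"
| "nblocks P1P1_Eight = 2"
| "nblocks P3_Eight = 1"

definition basis :: "scenario \<Rightarrow> gen set" where
  "basis s = H ` {..<nblocks s} \<union> E ` {..<npts s}"

definition Pic :: "scenario \<Rightarrow> cls set" where
  "Pic s = {l. \<forall>g. g \<notin> basis s \<longrightarrow> l g = 0}"

fun delta :: "scenario \<Rightarrow> cls" where
  "delta P2_Nine = (\<lambda>g. case g of H b \<Rightarrow> if b < 1 then 3 else 0 | E i \<Rightarrow> if i < 9 then - 1 else 0)"
| "delta P1P1_Eight = (\<lambda>g. case g of H b \<Rightarrow> if b < 2 then 2 else 0 | E i \<Rightarrow> if i < 8 then - 1 else 0)"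
| "delta P3_Eight = (\<lambda>g. case g of H b \<Rightarrow> if b < 1 then 2 else 0 | E i \<Rightarrow> if i < 8 then - 1 else 0)"

text \<open>Triple intersection numbers on the blow-up of 3-space: the cubes of the hyperplane class
  and of every exceptional class are 1, all mixed products of basis elements vanish.\<close>

definition triple :: "cls \<Rightarrow> cls \<Rightarrow> cls \<Rightarrow> int" where
  "triple l m n = l (H 0) * m (H 0) * n (H 0) + (\<Sum>i<8. l (E i) * m (E i) * n (E i))"

fun pair :: "scenario \<Rightarrow> cls \<Rightarrow> cls \<Rightarrow> int" where
  "pair P2_Nine l m = l (H 0) * m (H 0) - (\<Sum>i<9. l (E i) * m (E i))"
| "pair P1P1_Eight l m = l (H 0) * m (H 1) + l (H 1) * m (H 0) - (\<Sum>i<8. l (E i) * m (E i))"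
| "pair P3_Eight l m = triple l m (delta P3_Eight)"

lemma pair_P3_Eight: "pair P3_Eight l m = 2 * l (H 0) * m (H 0) - (\<Sum>i<8. l (E i) * m (E i))"
  by (simp add: triple_def sum_negf)

definition B :: "scenario \<Rightarrow> cls set" where
  "B s = {\<beta> \<in> Pic s. pair s \<beta> \<beta> = 0 \<and> pair s \<beta> (delta s) = 2}"

definition Q :: "scenario \<Rightarrow> cls set" where
  "Q s = {\<alpha> \<in> Pic s. pair s \<alpha> (delta s) = 0}"

text \<open>The linear action attributed to the birational involution of class \<open>\<beta>\<close>;
  the predicates \<open>is_involution\<close> and \<open>induces\<close> below give the geometric side.\<close>

definition I :: "scenario \<Rightarrow> cls \<Rightarrow> cls \<Rightarrow> cls" where
  "I s \<beta> l = (\<lambda>g. - l g + pair s l \<beta> * delta s g + pair s l (delta s) * \<beta> g)"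

text \<open>For \<open>\<alpha>\<close> in \<open>Q s\<close> the integer division by two is exact,
  see \<open>even_pair_Q\<close> below.\<close>

definition T :: "scenario \<Rightarrow> cls \<Rightarrow> cls \<Rightarrow> cls" where
  "T s \<alpha> l = (\<lambda>g. l g + pair s (delta s) l * \<alpha> g
       - ((pair s (delta s) l * pair s \<alpha> \<alpha>) div 2 + pair s \<alpha> l) * delta s g)"

lemma pair_delta:
  "pair P2_Nine l (delta P2_Nine) = 3 * l (H 0) + (\<Sum>i<9. l (E i))"
  "pair P1P1_Eight l (delta P1P1_Eight) = 2 * l (H 0) + 2 * l (H 1) + (\<Sum>i<8. l (E i))"
  "pair P3_Eight l (delta P3_Eight) = 4 * l (H 0) + (\<Sum>i<8. l (E i))"
  unfolding pair_P3_Eight by (simp_all add: sum_negf)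

lemma even_pair_Q:
  assumes "\<alpha> \<in> Q s"
  shows "even (pair s \<alpha> \<alpha>)"
proof -
  have sq: "even (a * a + a)" for a :: int
    by simp
  have sum_sq: "even ((\<Sum>i<n. \<alpha> (E i) * \<alpha> (E i)) + (\<Sum>i<n. \<alpha> (E i)))" for n
    unfolding sum.distrib[symmetric] by (intro dvd_sum sq)
  have 0: "pair s \<alpha> (delta s) = 0"
    using assms by (simp add: Q_def)
  have par: "even (k - S)" if "3 * h + e = 0" "even (S + e)" "even (k + h)" for h e S k :: int
    using that by presburger
  have par2: "even (2 * m - S)" if "2 * k + e = 0" "even (S + e)" for m e S k :: int
    using that by presburger
  show ?thesis
  proof (cases s)
    case P2_Nine
    show ?thesis
      using par[OF _ sum_sq sq] 0 unfolding P2_Nine pair_delta(1) unfolding pair.simps .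
  next
    case P1P1_Eight
    show ?thesis
      using par2[OF _ sum_sq, of "\<alpha> (H 0) + \<alpha> (H 1)" 8 "\<alpha> (H 0) * \<alpha> (H 1)"] 0
      unfolding P1P1_Eight pair_delta(2) unfolding pair.simps by (simp add: algebra_simps)
  next
    case P3_Eight
    show ?thesis
      using par2[OF _ sum_sq, of "2 * \<alpha> (H 0)" 8 "\<alpha> (H 0) * \<alpha> (H 0)"] 0
      unfolding P3_Eight pair_delta(3) unfolding pair_P3_Eight by (simp add: algebra_simps)
  qed
qed

lemma pair_diff_left: "pair s (a - b) c = pair s a c - pair s b c"
  by (cases s) (simp_all add: pair_P3_Eight sum_subtractf algebra_simps del: pair.simps(3))

lemma diff_B_in_Q: "\<lbrakk>\<beta>1 \<in> B s; \<beta>2 \<in> B s\<rbrakk> \<Longrightarrow> \<beta>1 - \<beta>2 \<in> Q s"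
  by (simp add: B_def Q_def pair_diff_left) (simp add: Pic_def)

text \<open>Points of the ambient space are given by homogeneous coordinate vectors over the complex
  numbers. In the product case the coordinates 0, 1 belong to the first line and 2, 3 to the
  second; \<open>block\<close> sends a coordinate to its factor.\<close>

type_synonym vec = "nat \<Rightarrow> complex"
type_synonym fn = "vec \<Rightarrow> complex"

fun ncoords :: "scenario \<Rightarrow> nat" where
  "ncoords P2_Nine = 3"
| "ncoords P1P1_Eight = 4"
| "ncoords P3_Eight = 4"

fun block :: "scenario \<Rightarrow> nat \<Rightarrow> nat" where
  "block P2_Nine i = 0"
| "block P1P1_Eight i = i div 2"
| "block P3_Eight i = 0"

definition point :: "scenario \<Rightarrow> vec \<Rightarrow> bool" where
  "point s p \<longleftrightarrow> (\<forall>i\<ge>ncoords s. p i = 0) \<and>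
     (\<forall>b<nblocks s. \<exists>i<ncoords s. block s i = b \<and> p i \<noteq> 0)"

definition scale :: "scenario \<Rightarrow> (nat \<Rightarrow> complex) \<Rightarrow> vec \<Rightarrow> vec" where
  "scale s c p = (\<lambda>i. c (block s i) * p i)"

definition proj_eq :: "scenario \<Rightarrow> vec \<Rightarrow> vec \<Rightarrow> bool" where
  "proj_eq s p q \<longleftrightarrow> (\<exists>c. (\<forall>b. c b \<noteq> 0) \<and> q = scale s c p)"

text \<open>Since the base field is infinite, polynomials are identified with polynomial functions.\<close>

inductive_set polyfun :: "scenario \<Rightarrow> fn set" for s where
  const: "(\<lambda>_. c) \<in> polyfun s"
| coord: "i < ncoords s \<Longrightarrow> (\<lambda>x. x i) \<in> polyfun s"
| add: "\<lbrakk>F \<in> polyfun s; G \<in> polyfun s\<rbrakk> \<Longrightarrow> (\<lambda>x. F x + G x) \<in> polyfun s"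
| mult: "\<lbrakk>F \<in> polyfun s; G \<in> polyfun s\<rbrakk> \<Longrightarrow> (\<lambda>x. F x * G x) \<in> polyfun s"

definition form :: "scenario \<Rightarrow> (nat \<Rightarrow> nat) \<Rightarrow> fn \<Rightarrow> bool" where
  "form s d F \<longleftrightarrow> F \<in> polyfun s \<and>
     (\<forall>c x. F (scale s c x) = (\<Prod>b<nblocks s. c b ^ d b) * F x)"

definition generic :: "scenario \<Rightarrow> (vec \<Rightarrow> bool) \<Rightarrow> bool" where
  "generic s R \<longleftrightarrow> (\<exists>d W. form s d W \<and> W \<noteq> 0 \<and> (\<forall>p. point s p \<and> W p \<noteq> 0 \<longrightarrow> R p))"

text \<open>Vanishing to order at least \<open>k\<close> at \<open>p\<close>, tested on all lines through
  the coordinate vector \<open>p\<close>. For a form this is the vanishing order of its dehomogenization.\<close>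

definition vanishes_to :: "nat \<Rightarrow> vec \<Rightarrow> fn \<Rightarrow> bool" where
  "vanishes_to k p F \<longleftrightarrow>
     (\<forall>v. \<exists>r :: complex poly. \<forall>t. F (\<lambda>i. p i + t * v i) = t ^ k * poly r t)"

definition mult_at :: "vec \<Rightarrow> fn \<Rightarrow> nat" where
  "mult_at p F = (GREATEST k. vanishes_to k p F)"

text \<open>Global sections of the line bundle of class \<open>l\<close> on the blow-up in the points
  \<open>P 0\<close>, \<open>P 1\<close>, ..., as forms on the ambient space. A positive coefficient of
  \<open>E i\<close> imposes no condition; the truncation by \<open>nat\<close> accounts for this.\<close>

definition sections :: "scenario \<Rightarrow> (nat \<Rightarrow> vec) \<Rightarrow> cls \<Rightarrow> fn set" where
  "sections s P l = {F. F = 0 \<or>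
     ((\<forall>b<nblocks s. 0 \<le> l (H b)) \<and> form s (\<lambda>b. nat (l (H b))) F \<and>
      (\<forall>i<npts s. vanishes_to (nat (- l (E i))) (P i) F))}"

definition through :: "scenario \<Rightarrow> (nat \<Rightarrow> vec) \<Rightarrow> cls \<Rightarrow> vec \<Rightarrow> fn set" where
  "through s P l p = {F \<in> sections s P l. F p = 0}"

text \<open>The linear system has projective dimension \<open>r\<close>, i.e. the space of sections has
  a basis \<open>G 0\<close>, ..., \<open>G r\<close>.\<close>

definition system_dim :: "scenario \<Rightarrow> (nat \<Rightarrow> vec) \<Rightarrow> cls \<Rightarrow> nat \<Rightarrow> bool" where
  "system_dim s P l r \<longleftrightarrow> (\<exists>G :: nat \<Rightarrow> fn.
     sections s P l = {(\<lambda>x. \<Sum>k\<le>r. a k * G k x) | a. True} \<and>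
     (\<forall>a. (\<forall>x. (\<Sum>k\<le>r. a k * G k x) = 0) \<longrightarrow> (\<forall>k\<le>r. a k = 0)))"

definition no_points_on :: "scenario \<Rightarrow> (nat \<Rightarrow> vec) \<Rightarrow> nat \<Rightarrow> (nat \<Rightarrow> nat) \<Rightarrow> bool" where
  "no_points_on s P k d \<longleftrightarrow> \<not> (\<exists>J F. J \<subseteq> {..<npts s} \<and> card J = k \<and>
     form s d F \<and> F \<noteq> 0 \<and> (\<forall>j\<in>J. F (P j) = 0))"

fun special_position :: "scenario \<Rightarrow> (nat \<Rightarrow> vec) \<Rightarrow> bool" where
  "special_position P2_Nine P \<longleftrightarrow> system_dim P2_Nine P (delta P2_Nine) 1"
| "special_position P1P1_Eight P \<longleftrightarrow> system_dim P1P1_Eight P (delta P1P1_Eight) 1"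
| "special_position P3_Eight P \<longleftrightarrow> system_dim P3_Eight P (delta P3_Eight) 2"

text \<open>The degrees \<open>\<lambda>_. 1\<close> and \<open>\<lambda>_. 2\<close> are those of lines (planes) and
  conics; in the product case the conditions exclude two points on a vertical or horizontal line
  and four points on a curve of bidegree (1,1).\<close>

fun otherwise_generic :: "scenario \<Rightarrow> (nat \<Rightarrow> vec) \<Rightarrow> bool" where
  "otherwise_generic P2_Nine P \<longleftrightarrow>
     no_points_on P2_Nine P 3 (\<lambda>_. 1) \<and> no_points_on P2_Nine P 6 (\<lambda>_. 2)"
| "otherwise_generic P1P1_Eight P \<longleftrightarrow>
     no_points_on P1P1_Eight P 2 (\<lambda>b. if b = 0 then 1 else 0) \<and>
     no_points_on P1P1_Eight P 2 (\<lambda>b. if b = 1 then 1 else 0) \<and>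
     no_points_on P1P1_Eight P 4 (\<lambda>_. 1)"
| "otherwise_generic P3_Eight P \<longleftrightarrow> no_points_on P3_Eight P 4 (\<lambda>_. 1)"

text \<open>The condition on the base locus is needed in 3-space, where eight points of a twisted
  cubic also lie on a net of quadrics.\<close>

definition configuration :: "scenario \<Rightarrow> (nat \<Rightarrow> vec) \<Rightarrow> bool" where
  "configuration s P \<longleftrightarrow>
     (\<forall>i<npts s. point s (P i)) \<and>
     (\<forall>i<npts s. \<forall>j<npts s. proj_eq s (P i) (P j) \<longrightarrow> i = j) \<and>
     special_position s P \<and> otherwise_generic s P \<and>
     (\<forall>q. point s q \<and> (\<forall>F\<in>sections s P (delta s). F q = 0) \<longrightarrow> (\<exists>i<npts s. proj_eq s (P i) q))"

text \<open>A dominant rational self-map of the ambient space (equivalently, of \<open>X\<close>) is given by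
  forms, of equal degree within each factor; common factors are allowed.\<close>

definition dominant_map :: "scenario \<Rightarrow> (vec \<Rightarrow> vec) \<Rightarrow> bool" where
  "dominant_map s f \<longleftrightarrow>
     (\<exists>e. \<forall>i<ncoords s. form s (e (block s i)) (\<lambda>x. f x i)) \<and>
     (\<forall>x. \<forall>i\<ge>ncoords s. f x i = 0) \<and>
     (\<forall>d F. form s d F \<and> F \<noteq> 0 \<longrightarrow> F \<circ> f \<noteq> 0)"

definition birational :: "scenario \<Rightarrow> (vec \<Rightarrow> vec) \<Rightarrow> bool" where
  "birational s f \<longleftrightarrow> dominant_map s f \<and>
     (\<exists>g. dominant_map s g \<and> generic s (\<lambda>p. proj_eq s (g (f p)) p) \<and>
          generic s (\<lambda>p. proj_eq s (f (g p)) p))"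

text \<open>Prime divisors of \<open>X\<close>: strict transforms of irreducible hypersurfaces and the
  exceptional divisors.\<close>

datatype divisor = Strict fn | Exc nat

definition is_const :: "fn \<Rightarrow> bool" where
  "is_const F \<longleftrightarrow> (\<exists>c. F = (\<lambda>_. c))"

fun prime_divisor :: "scenario \<Rightarrow> divisor \<Rightarrow> bool" where
  "prime_divisor s (Strict F) \<longleftrightarrow> (\<exists>d. form s d F) \<and> \<not> is_const F \<and>
     (\<forall>A\<in>polyfun s. \<forall>C\<in>polyfun s. F = (\<lambda>x. A x * C x) \<longrightarrow> is_const A \<or> is_const C)"
| "prime_divisor s (Exc i) \<longleftrightarrow> i < npts s"

fun has_class :: "scenario \<Rightarrow> (nat \<Rightarrow> vec) \<Rightarrow> divisor \<Rightarrow> cls \<Rightarrow> bool" where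
  "has_class s P (Strict F) l \<longleftrightarrow> (\<exists>d. form s d F \<and>
     l = (\<lambda>g. case g of H b \<Rightarrow> if b < nblocks s then int (d b) else 0
                      | E i \<Rightarrow> if i < npts s then - int (mult_at (P i) F) else 0))"
| "has_class s P (Exc i) l \<longleftrightarrow> l = (\<lambda>g. if g = E i then 1 else 0)"

text \<open>Order of vanishing of a nonzero form along a prime divisor of \<open>X\<close>.\<close>

fun ord :: "scenario \<Rightarrow> (nat \<Rightarrow> vec) \<Rightarrow> divisor \<Rightarrow> fn \<Rightarrow> nat" where
  "ord s P (Strict F) G = (GREATEST k. \<exists>C\<in>polyfun s. G = (\<lambda>x. F x ^ k * C x))"
| "ord s P (Exc i) G = mult_at (P i) G"

text \<open>\<open>f\<close> maps the prime divisor \<open>V\<close> onto the prime divisor \<open>V'\<close>: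
  for every rational function \<open>G / K\<close> the order of \<open>(G / K) \<circ> f\<close> along \<open>V\<close>
  is the order of \<open>G / K\<close> along \<open>V'\<close>. This also makes sense if one of them is
  exceptional, and if \<open>f\<close> is undefined along parts of \<open>V\<close>.\<close>

definition maps_onto :: "scenario \<Rightarrow> (nat \<Rightarrow> vec) \<Rightarrow> (vec \<Rightarrow> vec) \<Rightarrow> divisor \<Rightarrow> divisor \<Rightarrow> bool" where
  "maps_onto s P f V V' \<longleftrightarrow> (\<forall>d G K. form s d G \<and> form s d K \<and> G \<noteq> 0 \<and> K \<noteq> 0 \<longrightarrow>
     int (ord s P V (G \<circ> f)) - int (ord s P V (K \<circ> f)) = int (ord s P V' G) - int (ord s P V' K))"

text \<open>The birational self-map \<open>f\<close> of \<open>X\<close> permutes prime divisors (no divisor of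
  \<open>X\<close> is contracted), and the additive map \<open>\<phi>\<close> is the push-forward of divisor
  classes. As classes of prime divisors generate the Picard group, \<open>\<phi>\<close> is unique there.\<close>

definition induces :: "scenario \<Rightarrow> (nat \<Rightarrow> vec) \<Rightarrow> (vec \<Rightarrow> vec) \<Rightarrow> (cls \<Rightarrow> cls) \<Rightarrow> bool" where
  "induces s P f \<phi> \<longleftrightarrow> birational s f \<and>
     (\<forall>l\<in>Pic s. \<phi> l \<in> Pic s) \<and>
     (\<forall>l\<in>Pic s. \<forall>m\<in>Pic s. \<phi> (l + m) = \<phi> l + \<phi> m) \<and>
     (\<forall>V. prime_divisor s V \<longrightarrow> (\<exists>V'. prime_divisor s V' \<and> maps_onto s P f V V' \<and>
        (\<forall>l l'. has_class s P V l \<and> has_class s P V' l' \<longrightarrow> \<phi> l = l')))"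

text \<open>\<open>f\<close> is the involution attached to \<open>\<beta>\<close>: through a generic point \<open>p\<close>
  there is exactly one divisor of class \<open>\<beta>\<close>, and away from the base points it meets
  the divisors of class \<open>\<delta>\<close> through \<open>p\<close> (one curve in the surface cases, the
  members of a pencil in 3-space) exactly in \<open>p\<close> and the further point \<open>f p\<close>.\<close>

definition is_involution :: "scenario \<Rightarrow> (nat \<Rightarrow> vec) \<Rightarrow> cls \<Rightarrow> (vec \<Rightarrow> vec) \<Rightarrow> bool" where
  "is_involution s P \<beta> f \<longleftrightarrow> birational s f \<and> generic s (\<lambda>p.
     (\<exists>F. F \<noteq> 0 \<and> through s P \<beta> p = {(\<lambda>x. c * F x) | c. True}) \<and>
     \<not> proj_eq s p (f p) \<and>
     {q. point s q \<and> (\<forall>i<npts s. \<not> proj_eq s (P i) q) \<and>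
         (\<forall>F \<in> through s P \<beta> p \<union> through s P (delta s) p. F q = 0)}
       = {q. proj_eq s p q \<or> proj_eq s (f p) q})"

end

theory Submission
  imports Defs
begin

text \<open>The identity of linear maps is a computation with the bilinear form, using
  \<open>\<langle>\<delta>,\<delta>\<rangle> = 0\<close>. For the birational maps, pulling back forms along a dominant map preserves
  nonzero forms and equality of degrees. Hence genericity can be pulled back, which makes the
  composition of two birational maps birational, and the valuation identities that express that a
  prime divisor is mapped onto another one can be chained. So push-forward is functorial, and
  the identity of linear maps carries over.\<close>

section \<open>The bilinear form and the identity of linear maps\<close>

lemma pair_commute: "pair s a b = pair s b a"
  by (cases s) (simp_all add: pair_P3_Eight mult.commute del: pair.simps(3))

text \<open>The combination has the shape of \<open>I s \<beta> l\<close>, so that any pairing with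
  such a class expands in one rewrite.\<close>

lemma pair_linear_left:
  "pair s (\<lambda>g. - l g + a * m g + b * n g) x = - pair s l x + a * pair s m x + b * pair s n x"
  by (cases s)
    (simp_all add: pair_P3_Eight sum.distrib sum_subtractf sum_distrib_left algebra_simps
      del: pair.simps(3))

lemma pair_diff_right: "pair s c (a - b) = pair s c a - pair s c b"
  using pair_diff_left pair_commute by metis

lemma pair_delta_delta: "pair s (delta s) (delta s) = 0"
  by (cases s) (simp_all add: triple_def)

lemma I_comp_I:
  assumes "\<beta>1 \<in> B s" and "\<beta>2 \<in> B s"
  shows "I s \<beta>1 (I s \<beta>2 l) = T s (\<beta>1 - \<beta>2) l"
proof -
  have pair_I: "pair s (I s \<beta>2 l) x
      = - pair s l x + pair s l \<beta>2 * pair s (delta s) x + pair s l (delta s) * pair s \<beta>2 x" for x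
    unfolding I_def by (rule pair_linear_left)
  have B1: "pair s \<beta>1 \<beta>1 = 0" "pair s (delta s) \<beta>1 = 2"
    and B2: "pair s \<beta>2 \<beta>2 = 0" "pair s \<beta>2 (delta s) = 2"
    using assms by (auto simp: B_def pair_commute)
  have d: "pair s (I s \<beta>2 l) (delta s) = pair s l (delta s)"
    by (simp add: pair_I pair_delta_delta B2)
  have b: "pair s (I s \<beta>2 l) \<beta>1
      = - pair s l \<beta>1 + 2 * pair s l \<beta>2 + pair s l (delta s) * pair s \<beta>1 \<beta>2"
    by (simp add: pair_I B1 pair_commute[of s \<beta>2 \<beta>1])
  have "pair s (\<beta>1 - \<beta>2) (\<beta>1 - \<beta>2) = - 2 * pair s \<beta>1 \<beta>2"
    by (simp add: pair_diff_left pair_diff_right B1 B2 pair_commute[of s \<beta>2 \<beta>1])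
  \<comment> \<open>Isotropy of both classes makes the norm an explicit multiple of 2, so the
    \<open>div\<close> in \<open>T\<close> is exact.\<close>
  then have half: "(pair s (delta s) l * pair s (\<beta>1 - \<beta>2) (\<beta>1 - \<beta>2)) div 2
      = - pair s l (delta s) * pair s \<beta>1 \<beta>2"
    by (simp add: pair_commute[of s "delta s" l])
  \<comment> \<open>Only the outer \<open>I\<close> is unfolded, so that \<open>d\<close> and
    \<open>b\<close> can rewrite the pairings with the inner one.\<close>
  have "I s \<beta>1 (I s \<beta>2 l)
      = (\<lambda>g. - I s \<beta>2 l g + pair s (I s \<beta>2 l) \<beta>1 * delta s g
            + pair s (I s \<beta>2 l) (delta s) * \<beta>1 g)"
    by (rule I_def)
  then show ?thesis
    unfolding T_def half d b
    by (simp add: I_def pair_diff_left pair_commute[of s "delta s" l]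
        pair_commute[of s \<beta>1 l] pair_commute[of s \<beta>2 l] algebra_simps)
qed

subsection \<open>Forms and genericity\<close>

lemma polyfun_comp:
  assumes "F \<in> polyfun s" and "\<And>i. i < ncoords s \<Longrightarrow> (\<lambda>x. f x i) \<in> polyfun s"
  shows "F \<circ> f \<in> polyfun s"
  using assms(1) by induction (auto simp: comp_def intro: polyfun.intros assms(2))

text \<open>Restriction to lines reduces nonvanishing questions to univariate polynomials, an
  integral domain.\<close>

lemma polyfun_line:
  assumes "F \<in> polyfun s"
  shows "\<exists>r :: complex poly. \<forall>t. F (\<lambda>i. p i + t * v i) = poly r t"
  using assms
proof induction
  case (const c)
  show ?case by (rule exI[of _ "[:c:]"]) simp
next
  case (coord i)
  show ?case by (rule exI[of _ "[:p i, v i:]"]) simp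
next
  case (add F G)
  then show ?case by (metis poly_add)
next
  case (mult F G)
  then show ?case by (metis poly_mult)
qed

lemma polyfun_mult_nonzero:
  assumes "F \<in> polyfun s" "G \<in> polyfun s" "F \<noteq> 0" "G \<noteq> 0"
  shows "(\<lambda>x. F x * G x) \<noteq> 0"
proof
  assume zero: "(\<lambda>x. F x * G x) = 0"
  obtain p q where p: "F p \<noteq> 0" and q: "G q \<noteq> 0"
    using assms(3,4) by (auto simp: fun_eq_iff)
  \<comment> \<open>The line joining \<open>p\<close> (at \<open>t = 0\<close>) to \<open>q\<close>
    (at \<open>t = 1\<close>): neither factor vanishes identically on it.\<close>
  let ?x = "\<lambda>t i. p i + t * (q i - p i)"
  obtain r where r: "\<And>t. F (?x t) = poly r t"
    using polyfun_line[OF assms(1), of p "\<lambda>i. q i - p i"] by blast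
  obtain u where u: "\<And>t. G (?x t) = poly u t"
    using polyfun_line[OF assms(2), of p "\<lambda>i. q i - p i"] by blast
  have "poly (r * u) t = 0" for t
    using fun_cong[OF zero, of "?x t"] by (simp add: r u)
  then have "r * u = 0"
    using poly_all_0_iff_0 by blast
  moreover have "r \<noteq> 0"
    using r[of 0] p by auto
  moreover have "u \<noteq> 0"
    using u[of 1] q by auto
  ultimately show False
    by simp
qed

lemma form_mult:
  assumes "form s d F" "form s d' G"
  shows "form s (\<lambda>b. d b + d' b) (\<lambda>x. F x * G x)"
  using assms by (auto simp: form_def power_add prod.distrib intro: polyfun.mult)

lemma block_less: "i < ncoords s \<Longrightarrow> block s i < nblocks s"
  by (cases s) auto

lemma form_coord:
  assumes "i < ncoords s"
  shows "form s (\<lambda>b. if b = block s i then 1 else 0) (\<lambda>x. x i)"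
proof -
  have "(\<Prod>b<nblocks s. c b ^ (if b = block s i then 1 else 0)) = c (block s i)"
    for c :: "nat \<Rightarrow> complex"
    using block_less[OF assms] by (simp add: if_distrib[of "\<lambda>n. _ ^ n"] cong: if_cong)
  then show ?thesis
    using assms by (simp add: form_def scale_def polyfun.coord)
qed

text \<open>Meant for \<open>n = ncoords s\<close>, where a nonzero product certifies that every
  coordinate is nonzero; general \<open>n\<close> serves the induction.\<close>

lemma form_prod_coords:
  assumes "n \<le> ncoords s"
  shows "\<exists>d. form s d (\<lambda>x. \<Prod>i<n. x i)"
  using assms
proof (induction n)
  case 0
  have "form s (\<lambda>_. 0) (\<lambda>_. 1)"
    by (simp add: form_def polyfun.const)
  then show ?case by auto
next
  case (Suc n)
  then obtain d where "form s d (\<lambda>x. \<Prod>i<n. x i)"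
    by auto
  from form_mult[OF this form_coord[of n s]] Suc.prems show ?case
    by (auto simp: mult.commute)
qed

lemma generic_mono:
  assumes "generic s R" "\<And>p. R p \<Longrightarrow> R' p"
  shows "generic s R'"
  using assms unfolding generic_def by meson

text \<open>The product of the two witnessing forms is a nonzero form: two nonempty open sets of an
  irreducible space meet.\<close>

lemma generic_conj:
  assumes "generic s R" "generic s R'"
  shows "generic s (\<lambda>p. R p \<and> R' p)"
proof -
  obtain d W d' W' where W: "form s d W" "W \<noteq> 0" "\<And>p. point s p \<Longrightarrow> W p \<noteq> 0 \<Longrightarrow> R p"
    and W': "form s d' W'" "W' \<noteq> 0" "\<And>p. point s p \<Longrightarrow> W' p \<noteq> 0 \<Longrightarrow> R' p"
    using assms unfolding generic_def by blast
  have "(\<lambda>x. W x * W' x) \<noteq> 0"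
    using W(1,2) W'(1,2) polyfun_mult_nonzero unfolding form_def by blast
  then show ?thesis
    using form_mult[OF W(1) W'(1)] W(3) W'(3) unfolding generic_def
    by (intro exI[of _ "\<lambda>b. d b + d' b"] exI[of _ "\<lambda>x. W x * W' x"]) simp
qed

subsection \<open>Dominant and birational maps\<close>

text \<open>Here \<open>e b b'\<close> is the degree in factor \<open>b'\<close> of the coordinates
  of \<open>f\<close> in block \<open>b\<close>. Beyond \<open>ncoords s\<close> both sides are
  0.\<close>

lemma dominant_map_scale:
  assumes "dominant_map s f"
  obtains e where "\<And>c x. f (scale s c x) = scale s (\<lambda>b. \<Prod>b'<nblocks s. c b' ^ e b b') (f x)"
proof -
  obtain e where e: "\<forall>i<ncoords s. form s (e (block s i)) (\<lambda>x. f x i)"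
    and 0: "\<And>x i. i \<ge> ncoords s \<Longrightarrow> f x i = 0"
    using assms unfolding dominant_map_def by blast
  have "f (scale s c x) i = scale s (\<lambda>b. \<Prod>b'<nblocks s. c b' ^ e b b') (f x) i" for c x i
    using e 0 by (cases "i < ncoords s") (auto simp: form_def scale_def[of s _ "f x"])
  then show thesis
    using that by blast
qed

text \<open>Multidegrees transform by the transpose of the matrix \<open>e\<close>. One
  \<open>h\<close> serves all forms, so forms of equal degree pull back to forms of equal degree, as
  quotients of forms require.\<close>

lemma form_comp_dominant:
  assumes "dominant_map s f"
  obtains h where "\<And>d F. form s d F \<Longrightarrow> form s (h d) (F \<circ> f)"
proof -
  obtain e where e: "\<And>c x. f (scale s c x)
      = scale s (\<lambda>b. \<Prod>b'<nblocks s. c b' ^ e b b') (f x)"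
    using dominant_map_scale[OF assms] by blast
  have "form s (\<lambda>b'. \<Sum>b<nblocks s. e b b' * d b) (F \<circ> f)" if "form s d F" for d F
  proof -
    have "F \<circ> f \<in> polyfun s"
      using that assms unfolding form_def dominant_map_def by (blast intro: polyfun_comp)
    moreover have "(\<Prod>b<nblocks s. (\<Prod>b'<nblocks s. c b' ^ e b b') ^ d b)
        = (\<Prod>b'<nblocks s. c b' ^ (\<Sum>b<nblocks s. e b b' * d b))" for c :: "nat \<Rightarrow> complex"
      unfolding prod_power_distrib power_mult[symmetric] power_sum
      by (rule prod.swap)
    ultimately show ?thesis
      using that by (simp add: form_def e)
  qed
  then show thesis
    by (rule that)
qed

lemma dominant_map_comp:
  assumes "dominant_map s f" "dominant_map s g"
  shows "dominant_map s (f \<circ> g)"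
proof -
  obtain h where h: "\<And>d F. form s d F \<Longrightarrow> form s (h d) (F \<circ> g)"
    using form_comp_dominant[OF assms(2)] by blast
  obtain h' where h': "\<And>d F. form s d F \<Longrightarrow> form s (h' d) (F \<circ> f)"
    using form_comp_dominant[OF assms(1)] by blast
  obtain e where "\<forall>i<ncoords s. form s (e (block s i)) (\<lambda>x. f x i)"
    using assms(1) unfolding dominant_map_def by blast
  then have "\<forall>i<ncoords s. form s (h (e (block s i))) (\<lambda>x. (f \<circ> g) x i)"
    using h unfolding comp_def by blast
  \<comment> \<open>\<open>F \<circ> f\<close> is again a nonzero form, so dominance of
    \<open>g\<close> applies to it.\<close>
  moreover have "F \<circ> (f \<circ> g) \<noteq> 0" if "form s d F" "F \<noteq> 0" for d F
    using that assms h'[OF that(1)] unfolding dominant_map_def comp_assoc[symmetric] by blast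
  moreover have "\<forall>x. \<forall>i\<ge>ncoords s. (f \<circ> g) x i = 0"
    using assms(1) unfolding dominant_map_def by simp
  ultimately show ?thesis
    unfolding dominant_map_def by (intro conjI exI[of _ "\<lambda>b. h (e b)"]) blast+
qed

text \<open>Dominance keeps the pullback of the witnessing form nonzero, so it is a witness
  again.\<close>

lemma generic_pullback:
  assumes f: "dominant_map s f" and "generic s R"
  shows "generic s (\<lambda>p. R (f p))"
proof -
  obtain d W where W: "form s d W" "W \<noteq> 0" "\<And>p. point s p \<Longrightarrow> W p \<noteq> 0 \<Longrightarrow> R p"
    using assms(2) unfolding generic_def by blast
  \<comment> \<open>The values of \<open>f\<close> may fail to be points, but not where all their coordinates are nonzero.\<close>
  define X :: fn where "X = (\<lambda>x. \<Prod>i<ncoords s. x i)"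
  obtain d' where X: "form s d' X"
    using form_prod_coords unfolding X_def by blast
  have "X (\<lambda>_. 1) \<noteq> 0"
    by (simp add: X_def)
  then have "X \<noteq> 0"
    by auto
  define V where "V = (\<lambda>x. W x * X x)"
  have V: "form s (\<lambda>b. d b + d' b) V"
    unfolding V_def by (rule form_mult[OF W(1) X])
  have "V \<noteq> 0"
    unfolding V_def using polyfun_mult_nonzero W(1,2) X \<open>X \<noteq> 0\<close> form_def by blast
  then have "V \<circ> f \<noteq> 0"
    using f V unfolding dominant_map_def by blast
  \<comment> \<open>The coordinate \<open>2 * b\<close> lies in block \<open>b\<close> in all
    scenarios: the product case has two coordinates per block, the others only
    \<open>b = 0\<close>.\<close>
  have block: "\<exists>i<ncoords s. block s i = b" if "b < nblocks s" for b
  proof (intro exI conjI)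
    show "2 * b < ncoords s" "block s (2 * b) = b"
      using that by (cases s; simp)+
  qed
  have "R (f p)" if "(V \<circ> f) p \<noteq> 0" for p
  proof (rule W(3))
    have "\<forall>i<ncoords s. f p i \<noteq> 0"
      using that by (auto simp: V_def X_def)
    then show "point s (f p)"
      using f block unfolding point_def dominant_map_def by metis
    show "W (f p) \<noteq> 0"
      using that by (auto simp: V_def)
  qed
  then show ?thesis
    using form_comp_dominant[OF f] V \<open>V \<circ> f \<noteq> 0\<close> unfolding generic_def by metis
qed

lemma proj_eqI:
  assumes "\<And>b. c b \<noteq> 0" "q = scale s c p"
  shows "proj_eq s p q"
  using assms unfolding proj_eq_def by blast

lemma proj_eq_trans:
  assumes "proj_eq s p q" "proj_eq s q r"
  shows "proj_eq s p r"
proof -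
  obtain c c' where "\<forall>b. c b \<noteq> 0" "q = scale s c p" "\<forall>b. c' b \<noteq> 0" "r = scale s c' q"
    using assms unfolding proj_eq_def by blast
  then show ?thesis
    by (intro proj_eqI[of "\<lambda>b. c' b * c b"]) (simp_all add: scale_def mult.assoc)
qed

lemma dominant_map_proj_eq:
  assumes "dominant_map s f" "proj_eq s p q"
  shows "proj_eq s (f p) (f q)"
proof -
  obtain c where c: "\<forall>b. c b \<noteq> 0" "q = scale s c p"
    using assms(2) unfolding proj_eq_def by blast
  obtain e where "f q = scale s (\<lambda>b. \<Prod>b'<nblocks s. c b' ^ e b b') (f p)"
    using dominant_map_scale[OF assms(1)] c(2) by metis
  then show ?thesis
    using c(1) by (intro proj_eqI[of "\<lambda>b. \<Prod>b'<nblocks s. c b' ^ e b b'"]) simp_all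
qed

text \<open>The condition on \<open>g\<close> is pulled back along \<open>f\<close>, and
  \<open>f'\<close> carries the resulting equivalence over. Exchanging the roles of the maps gives
  both inverse laws of a composition.\<close>

lemma generic_inverse_comp:
  assumes "dominant_map s f" "dominant_map s f'"
    and "generic s (\<lambda>p. proj_eq s (f' (f p)) p)" "generic s (\<lambda>p. proj_eq s (g' (g p)) p)"
  shows "generic s (\<lambda>p. proj_eq s ((f' \<circ> g') ((g \<circ> f) p)) p)"
  using generic_conj[OF assms(3) generic_pullback[OF assms(1,4)]]
proof (rule generic_mono)
  fix p
  assume "proj_eq s (f' (f p)) p \<and> proj_eq s (g' (g (f p))) (f p)"
  then have "proj_eq s (f' (g' (g (f p)))) (f' (f p))" "proj_eq s (f' (f p)) p"
    using dominant_map_proj_eq[OF assms(2)] by simp_all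
  then show "proj_eq s ((f' \<circ> g') ((g \<circ> f) p)) p"
    unfolding comp_apply by (rule proj_eq_trans)
qed

lemma birational_comp:
  assumes "birational s f" "birational s g"
  shows "birational s (f \<circ> g)"
proof -
  obtain f' where f: "dominant_map s f" "dominant_map s f'"
    "generic s (\<lambda>p. proj_eq s (f' (f p)) p)" "generic s (\<lambda>p. proj_eq s (f (f' p)) p)"
    using assms(1) unfolding birational_def by (elim conjE exE) (rule that)
  obtain g' where g: "dominant_map s g" "dominant_map s g'"
    "generic s (\<lambda>p. proj_eq s (g' (g p)) p)" "generic s (\<lambda>p. proj_eq s (g (g' p)) p)"
    using assms(2) unfolding birational_def by (elim conjE exE) (rule that)
  show ?thesis
    unfolding birational_def
  proof (intro conjI exI)
    show "dominant_map s (f \<circ> g)" "dominant_map s (g' \<circ> f')"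
      by (intro dominant_map_comp f(1,2) g(1,2))+
    show "generic s (\<lambda>p. proj_eq s ((g' \<circ> f') ((f \<circ> g) p)) p)"
      by (rule generic_inverse_comp) (fact g f)+
    show "generic s (\<lambda>p. proj_eq s ((f \<circ> g) ((g' \<circ> f') p)) p)"
      by (rule generic_inverse_comp) (fact g f)+
  qed
qed

subsection \<open>Functoriality of push-forward\<close>

text \<open>The identity for \<open>g\<close> is tested on the pullbacks of \<open>G\<close> and
  \<open>K\<close> along \<open>f\<close>, which are nonzero forms of one common degree
  \<open>h d\<close>.\<close>

lemma maps_onto_comp:
  assumes f: "dominant_map s f" and "maps_onto s P g U V" "maps_onto s P f V W"
  shows "maps_onto s P (f \<circ> g) U W"
  unfolding maps_onto_def
proof (intro allI impI, elim conjE)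
  fix d G K
  assume G: "form s d G" "G \<noteq> 0" and K: "form s d K" "K \<noteq> 0"
  obtain h where "\<And>d F. form s d F \<Longrightarrow> form s (h d) (F \<circ> f)"
    using form_comp_dominant[OF f] by blast
  then have "form s (h d) (G \<circ> f)" "form s (h d) (K \<circ> f)"
    using G K by auto
  moreover have "G \<circ> f \<noteq> 0" "K \<circ> f \<noteq> 0"
    using f G K unfolding dominant_map_def by blast+
  ultimately have "int (ord s P U (G \<circ> f \<circ> g)) - int (ord s P U (K \<circ> f \<circ> g))
      = int (ord s P V (G \<circ> f)) - int (ord s P V (K \<circ> f))"
    using assms(2) unfolding maps_onto_def by blast
  also have "\<dots> = int (ord s P W G) - int (ord s P W K)"
    using assms(3) G K unfolding maps_onto_def by blast
  finally show "int (ord s P U (G \<circ> (f \<circ> g))) - int (ord s P U (K \<circ> (f \<circ> g)))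
      = int (ord s P W G) - int (ord s P W K)"
    by (simp add: comp_assoc)
qed

lemma prime_divisor_has_class:
  assumes "prime_divisor s V"
  obtains l where "has_class s P V l"
  using assms by (cases V) auto

text \<open>A prime divisor \<open>U\<close> goes to \<open>V\<close> under \<open>g\<close> and on
  to \<open>W\<close> under \<open>f\<close>; the orders chain, and so do the classes.\<close>

lemma induces_comp:
  assumes f: "induces s P f \<phi>" and g: "induces s P g \<psi>"
  shows "induces s P (f \<circ> g) (\<phi> \<circ> \<psi>)"
  unfolding induces_def
proof (intro conjI allI ballI impI)
  show "birational s (f \<circ> g)"
    using f g birational_comp unfolding induces_def by blast
  show "(\<phi> \<circ> \<psi>) l \<in> Pic s" if "l \<in> Pic s" for l
    using that f g unfolding induces_def by simp
  show "(\<phi> \<circ> \<psi>) (l + m) = (\<phi> \<circ> \<psi>) l + (\<phi> \<circ> \<psi>) m" if "l \<in> Pic s" "m \<in> Pic s" for l m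
    using that f g unfolding induces_def by simp
  fix U
  assume "prime_divisor s U"
  then obtain V where V: "prime_divisor s V" "maps_onto s P g U V"
    "\<And>l l'. has_class s P U l \<Longrightarrow> has_class s P V l' \<Longrightarrow> \<psi> l = l'"
    using g unfolding induces_def by blast
  then obtain W where W: "prime_divisor s W" "maps_onto s P f V W"
    "\<And>l l'. has_class s P V l \<Longrightarrow> has_class s P W l' \<Longrightarrow> \<phi> l = l'"
    using f unfolding induces_def by blast
  \<comment> \<open>Both class conditions quantify over classes of \<open>V\<close>; an actual class
    is required to link them.\<close>
  obtain k where "has_class s P V k"
    using prime_divisor_has_class[OF V(1)] by blast
  then have "(\<phi> \<circ> \<psi>) l = l'" if "has_class s P U l" "has_class s P W l'" for l l'
    using that V(3) W(3) by simp
  moreover have "maps_onto s P (f \<circ> g) U W"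
    using maps_onto_comp V(2) W(2) f unfolding induces_def birational_def by blast
  ultimately show "\<exists>W. prime_divisor s W \<and> maps_onto s P (f \<circ> g) U W \<and>
      (\<forall>l l'. has_class s P U l \<and> has_class s P W l' \<longrightarrow> (\<phi> \<circ> \<psi>) l = l')"
    using W(1) by blast
qed

theorem theorem2:
  fixes s :: scenario and \<beta>1 \<beta>2 :: cls
  assumes "\<beta>1 \<in> B s" and "\<beta>2 \<in> B s"
  shows "(\<forall>l\<in>Pic s. (I s \<beta>1 \<circ> I s \<beta>2) l = T s (\<beta>1 - \<beta>2) l) \<and>
    (\<forall>(P :: nat \<Rightarrow> vec) (f1 :: vec \<Rightarrow> vec) (f2 :: vec \<Rightarrow> vec).
       configuration s P \<and>
       is_involution s P \<beta>1 f1 \<and> induces s P f1 (I s \<beta>1) \<and>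
       is_involution s P \<beta>2 f2 \<and> induces s P f2 (I s \<beta>2)
       \<longrightarrow> induces s P (f1 \<circ> f2) (T s (\<beta>1 - \<beta>2)))"
proof -
  \<comment> \<open>Equality as functions, beyond \<open>Pic s\<close>, allows substitution inside
    \<open>induces\<close>.\<close>
  have "I s \<beta>1 \<circ> I s \<beta>2 = T s (\<beta>1 - \<beta>2)"
    using I_comp_I[OF assms] by (simp add: fun_eq_iff)
  then show ?thesis
    using induces_comp by metis
qed

end
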